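(* Let $X=V(T_1^{l_1}+T_2^{l_2}+1)\subseteq\mathbb{C}^n$ be a trinomial hypersurface of Type 1. The following conditions are equivalent. (i) The hypersurface $X$ admits a horizontal polynomial curve. (ii) We have $l_{ij}=1$ for some $i\in\{1,2\}$ and some $j\in\{1,\ldots,n_i\}$.
   Context: The ground field is $\mathbb{C}$. Trinomial hypersurface of Type 1: fix positive integers $n_1,n_2$ and let $n=n_1+n_2$. For each $i=1,2$ take a tuple $l_i=(l_{i1},\ldots,l_{in_i})\in\mathbb{Z}_{>0}^{n_i}$ and put $T_i^{l_i}:=T_{i1}^{l_{i1}}\cdots T_{in_i}^{l_{in_i}}\in\mathbb{C}[T_{ij};\ i=1,2,\ j=1,\ldots,n_i]$. The trinomial hypersurface of Type 1 is the zero set $X=V(T_1^{l_1}+T_2^{l_2}+1)\subseteq\mathbb{C}^n$; it is an irreducible smooth affine variety of dimension $n-1$. Torus action: the group of all invertible diagonal matrices acts on $\mathbb{C}^n$ by scaling the coordinates $T_{ij}$. Consider the subgroup of those diagonal matrices for which the scaling factors $w_{ij}$ (written additively as weights of the coordinates $T_{ij}$) satisfy $\sum_{j=1}^{n_1} l_{1j}w_{1j}=\sum_{j=1}^{n_2} l_{2j}w_{2j}=0$, i.e. both monomials $T_1^{l_1}$ and $T_2^{l_2}$ are invariant. Let $T$ be the connected component of the identity of this subgroup; it is a torus of codimension $2$ in the diagonal torus, and it acts effectively on $X$ with complexity $\dim X-\dim T=1$. A polynomial curve on an algebraic variety $X$ is a non-constant morphism $\tau\colon\mathbb{C}\to X$.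 A polynomial curve $\tau\colon\mathbb{C}\to X$ on an irreducible $T$-variety $X$ is called horizontal if there exists a nonempty $T$-invariant open subset $W$ of $X$ such that $\tau(\mathbb{C})$ intersects all $T$-orbits on $W$. For trinomial hypersurfaces, horizontal is meant with respect to the torus $T$ just described. *)

theory Defs
  imports "HOL-Analysis.Analysis" "HOL-Computational_Algebra.Polynomial"
begin

inductive polynomial_fun :: "(complex ^ 'k::finite \<Rightarrow> complex) \<Rightarrow> bool" where
  const: "polynomial_fun (\<lambda>x. c)"
| coord: "polynomial_fun (\<lambda>x. x $ k)"
| add: "polynomial_fun f \<Longrightarrow> polynomial_fun g \<Longrightarrow> polynomial_fun (\<lambda>x. f x + g x)"
| mult: "polynomial_fun f \<Longrightarrow> polynomial_fun g \<Longrightarrow> polynomial_fun (\<lambda>x. f x * g x)"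

definition zero_locus :: "(complex ^ 'k::finite \<Rightarrow> complex) set \<Rightarrow> (complex ^ 'k) set" where
  "zero_locus F = {x. \<forall>f\<in>F. f x = 0}"

definition zariski :: "(complex ^ 'k::finite) topology" where
  "zariski = topology (\<lambda>U. \<exists>F. F \<subseteq> Collect polynomial_fun \<and> - U = zero_locus F)"

lemma istopology_zariski:
  "istopology (\<lambda>U :: (complex ^ 'k::finite) set.
     \<exists>F. F \<subseteq> Collect polynomial_fun \<and> - U = zero_locus F)"
  unfolding istopology_def
proof (intro conjI allI impI)
  fix S T :: "(complex ^ 'k) set"
  assume "\<exists>F. F \<subseteq> Collect polynomial_fun \<and> - S = zero_locus F"
    and "\<exists>F. F \<subseteq> Collect polynomial_fun \<and> - T = zero_locus F"
  then obtain F G where F: "F \<subseteq> Collect polynomial_fun" "- S = zero_locus F"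
    and G: "G \<subseteq> Collect polynomial_fun" "- T = zero_locus G" by blast
  define H where "H = (\<lambda>(f, g). \<lambda>x. f x * g x) ` (F \<times> G)"
  have "H \<subseteq> Collect polynomial_fun"
    using F(1) G(1) by (auto simp: H_def intro!: polynomial_fun.mult)
  moreover have "- (S \<inter> T) = zero_locus H"
    unfolding Compl_Int F(2) G(2) by (auto simp: zero_locus_def H_def)
  ultimately show "\<exists>F. F \<subseteq> Collect polynomial_fun \<and> - (S \<inter> T) = zero_locus F"
    by blast
next
  fix K :: "(complex ^ 'k) set set"
  assume "\<forall>S\<in>K. \<exists>F. F \<subseteq> Collect polynomial_fun \<and> - S = zero_locus F"
  then obtain F where F: "\<And>S. S \<in> K \<Longrightarrow> F S \<subseteq> Collect polynomial_fun"
    "\<And>S. S \<in> K \<Longrightarrow> - S = zero_locus (F S)" by metis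
  have "- \<Union>K = (\<Inter>S\<in>K. - S)" by blast
  also have "\<dots> = (\<Inter>S\<in>K. zero_locus (F S))" using F(2) by simp
  also have "\<dots> = zero_locus (\<Union>S\<in>K. F S)" by (auto simp: zero_locus_def)
  finally show "\<exists>F. F \<subseteq> Collect polynomial_fun \<and> - \<Union>K = zero_locus F"
    using F(1) by (intro exI[of _ "\<Union>S\<in>K. F S"]) blast
qed

lemma openin_zariski:
  "openin zariski U \<longleftrightarrow> (\<exists>F. F \<subseteq> Collect polynomial_fun \<and> - U = zero_locus F)"
  unfolding zariski_def topology_inverse'[OF istopology_zariski] ..

text \<open>A morphism from the affine line to a closed subset of affine space is a tuple of
  univariate polynomials whose values lie in that subset.\<close>

definition polynomial_curve ::
  "(complex ^ 'k::finite) set \<Rightarrow> (complex \<Rightarrow> complex ^ 'k) \<Rightarrow> bool" where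
  "polynomial_curve X \<tau> \<longleftrightarrow>
     (\<exists>p :: 'k \<Rightarrow> complex poly. \<forall>t. \<tau> t = (\<chi> k. poly (p k) t)) \<and>
     range \<tau> \<subseteq> X \<and> \<not> \<tau> constant_on UNIV"

text \<open>An invertible diagonal matrix is represented by the vector of its diagonal entries. The
  product of vectors is componentwise, so \<open>w * x\<close> is the action of the diagonal matrix \<open>w\<close>
  on the point \<open>x\<close>, and \<open>1\<close> is the identity matrix.\<close>

definition torus_orbit :: "(complex ^ 'k::finite) set \<Rightarrow> complex ^ 'k \<Rightarrow> (complex ^ 'k) set" where
  "torus_orbit T x = (\<lambda>w. w * x) ` T"

definition horizontal_curve ::
  "(complex ^ 'k::finite) set \<Rightarrow> (complex ^ 'k) set \<Rightarrow> (complex \<Rightarrow> complex ^ 'k) \<Rightarrow> bool" where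
  "horizontal_curve T X \<tau> \<longleftrightarrow> polynomial_curve X \<tau> \<and>
     (\<exists>W. W \<noteq> {} \<and> openin (subtopology zariski X) W \<and>
        (\<forall>x\<in>W. torus_orbit T x \<subseteq> W) \<and>
        (\<forall>x\<in>W. range \<tau> \<inter> torus_orbit T x \<noteq> {}))"

text \<open>The coordinates \<open>T\<^sub>1\<^sub>j\<close> and \<open>T\<^sub>2\<^sub>j\<close> are indexed by \<open>Inl j\<close> and \<open>Inr j\<close>, with
  \<open>n\<^sub>1 = CARD('a)\<close> and \<open>n\<^sub>2 = CARD('b)\<close>.\<close>

definition monomial1 :: "('a::finite \<Rightarrow> nat) \<Rightarrow> complex ^ ('a + 'b::finite) \<Rightarrow> complex" where
  "monomial1 l1 x = (\<Prod>j\<in>UNIV. x $ Inl j ^ l1 j)"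

definition monomial2 :: "('b::finite \<Rightarrow> nat) \<Rightarrow> complex ^ ('a::finite + 'b) \<Rightarrow> complex" where
  "monomial2 l2 x = (\<Prod>j\<in>UNIV. x $ Inr j ^ l2 j)"

definition trinomial_hypersurface ::
  "('a::finite \<Rightarrow> nat) \<Rightarrow> ('b::finite \<Rightarrow> nat) \<Rightarrow> (complex ^ ('a + 'b)) set" where
  "trinomial_hypersurface l1 l2 = {x. monomial1 l1 x + monomial2 l2 x + 1 = 0}"

text \<open>Both monomials are invariant under the diagonal matrix \<open>w\<close> iff they take the value 1
  at \<open>w\<close>; additively, the \<open>l\<^sub>i\<close>-weighted sums of the weights vanish.\<close>

definition trinomial_quasitorus ::
  "('a::finite \<Rightarrow> nat) \<Rightarrow> ('b::finite \<Rightarrow> nat) \<Rightarrow> (complex ^ ('a + 'b)) set" where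
  "trinomial_quasitorus l1 l2 =
     {w. (\<forall>k. w $ k \<noteq> 0) \<and> monomial1 l1 w = 1 \<and> monomial2 l2 w = 1}"

definition trinomial_torus ::
  "('a::finite \<Rightarrow> nat) \<Rightarrow> ('b::finite \<Rightarrow> nat) \<Rightarrow> (complex ^ ('a + 'b)) set" where
  "trinomial_torus l1 l2 =
     connected_component_of_set (subtopology zariski (trinomial_quasitorus l1 l2)) 1"

end

theory Submission
  imports Defs
begin

text \<open>If all exponents are at least 2, the monomials along a polynomial curve are polynomials \<open>f\<close>,
  \<open>g\<close> with \<open>f + g + 1 = 0\<close> and without simple roots. By the Mason--Stothers argument they are
  constant, whereas a horizontal curve would meet every torus orbit in a nonempty open subset of
  the hypersurface, on which the monomials are not constant. Conversely, if \<open>l\<^sub>1\<^sub>j = 1\<close>, put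
  \<open>t\<close> in one coordinate of the second block, \<open>- 1 - t ^ m\<close> in the \<open>j\<close>-th coordinate of the
  first one, and \<open>1\<close> elsewhere, where \<open>m\<close> is the exponent of the coordinate \<open>t\<close>. This curve
  meets the orbit of every point with nonzero coordinates.\<close>

text \<open>A monomial as a function of a single block of coordinates, so that the facts below apply
  to either block and the two blocks can exchange roles.\<close>

definition monom_fun :: "('a::finite \<Rightarrow> nat) \<Rightarrow> ('a \<Rightarrow> complex) \<Rightarrow> complex" where
  "monom_fun l u = (\<Prod>j\<in>UNIV. u j ^ l j)"

lemma monomial1_eq: "monomial1 l x = monom_fun l (\<lambda>j. x $ Inl j)"
  by (simp add: monomial1_def monom_fun_def)

lemma monomial2_eq: "monomial2 l x = monom_fun l (\<lambda>j. x $ Inr j)"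
  by (simp add: monomial2_def monom_fun_def)

lemma monom_fun_mult: "monom_fun l (\<lambda>j. u j * v j) = monom_fun l u * monom_fun l v"
  by (simp add: monom_fun_def power_mult_distrib prod.distrib)

lemma monom_fun_exp: "monom_fun l (\<lambda>j. exp (u j)) = exp (\<Sum>j\<in>UNIV. of_nat (l j) * u j)"
  by (simp add: monom_fun_def exp_sum exp_of_nat_mult)

lemma monom_fun_update_one:
  "monom_fun l (\<lambda>j. if j = k then z else 1) = z ^ l k"
proof -
  have "monom_fun l (\<lambda>j. if j = k then z else 1) = (\<Prod>j\<in>UNIV. if j = k then z ^ l j else 1)"
    unfolding monom_fun_def by (rule prod.cong) auto
  then show ?thesis by simp
qed

lemma poly_monom_fun:
  "monom_fun l (\<lambda>j. poly (p j) t) = poly (\<Prod>j\<in>UNIV. p j ^ l j) t"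
  by (simp add: monom_fun_def poly_prod)

subsection \<open>Euclidean and Zariski topology\<close>

lemma continuous_on_polynomial_fun: "polynomial_fun f \<Longrightarrow> continuous_on UNIV f"
  by (induction rule: polynomial_fun.induct) (auto intro!: continuous_intros)

text \<open>Polynomials are continuous, so zero loci are Euclidean closed. This comparison serves
  twice: paths yield Zariski connectedness, and limits yield points of Zariski open sets.\<close>

lemma open_if_openin_zariski:
  assumes "openin zariski U"
  shows "open U"
proof -
  obtain F where F: "F \<subseteq> Collect polynomial_fun" "- U = zero_locus F"
    using assms by (auto simp: openin_zariski)
  have "zero_locus F = (\<Inter>f\<in>F. f -` {0})"
    by (auto simp: zero_locus_def)
  moreover have "closed (f -` {0})" if "f \<in> F" for f
    using F(1) that continuous_on_polynomial_fun[of f]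
    by (intro closed_vimage) (auto simp: continuous_on_eq_continuous_at)
  ultimately have "closed (zero_locus F)" by auto
  then show ?thesis using F(2) by (metis open_closed)
qed

lemma polynomial_fun_prod:
  "finite A \<Longrightarrow> (\<And>k. k \<in> A \<Longrightarrow> polynomial_fun (f k)) \<Longrightarrow> polynomial_fun (\<lambda>x. \<Prod>k\<in>A. f k x)"
  by (induction rule: finite_induct) (auto intro: polynomial_fun.intros)

lemma openin_zariski_torus: "openin zariski {x :: complex ^ 'k::finite. \<forall>k. x $ k \<noteq> 0}"
proof -
  have "polynomial_fun (\<lambda>x :: complex ^ 'k. \<Prod>k\<in>UNIV. x $ k)"
    by (intro polynomial_fun_prod) (auto intro: polynomial_fun.intros)
  then show ?thesis unfolding openin_zariski
    by (intro exI[of _ "{\<lambda>x :: complex ^ 'k. \<Prod>k\<in>UNIV. x $ k}"]) (auto simp: zero_locus_def)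
qed

lemma connectedin_zariski:
  assumes "connected S" "S \<subseteq> Y"
  shows "connectedin (subtopology zariski Y) S"
proof -
  have top: "topspace zariski = (UNIV :: (complex ^ 'k::finite) set)"
  proof -
    have "openin zariski (UNIV :: (complex ^ 'k::finite) set)"
      unfolding openin_zariski
      by (intro exI[of _ "{\<lambda>x. 1}"]) (auto simp: zero_locus_def intro: polynomial_fun.intros)
    then show ?thesis using openin_subset by blast
  qed
  have "connectedin zariski S"
    using assms(1) unfolding connectedin top connected_def
    by (auto dest!: open_if_openin_zariski)
  then show ?thesis using assms(2) by (simp add: connectedin_subtopology)
qed

subsection \<open>The torus\<close>

lemma trinomial_torus_subset: "trinomial_torus l1 l2 \<subseteq> trinomial_quasitorus l1 l2"
  unfolding trinomial_torus_def
  using connected_component_of_subset_topspace[of "subtopology zariski (trinomial_quasitorus l1 l2)" 1]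
  by auto

text \<open>Scaling \<open>a\<close> by \<open>s\<close> preserves both linear equations, so the
  path \<open>exp (s * a k)\<close> for \<open>s\<close> from 0 to 1 stays in the quasitorus and
  joins \<open>1\<close> to the given element.\<close>

lemma exp_in_trinomial_torus:
  fixes a :: "'a::finite + 'b::finite \<Rightarrow> complex"
  assumes "(\<Sum>j\<in>UNIV. of_nat (l1 j) * a (Inl j)) = 0" "(\<Sum>j\<in>UNIV. of_nat (l2 j) * a (Inr j)) = 0"
  shows "(\<chi> k. exp (a k)) \<in> trinomial_torus l1 l2"
proof -
  define g where "g = (\<lambda>s::real. \<chi> k. exp (of_real s * a k))"
  have sum0: "(\<Sum>j\<in>UNIV. of_nat (l j) * (c * b j)) = 0"
    if "(\<Sum>j\<in>UNIV. of_nat (l j) * b j) = 0" for l :: "'c::finite \<Rightarrow> nat" and b and c :: complex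
    using that by (simp add: mult.left_commute[of _ c] flip: sum_distrib_left)
  have sub: "g ` {0..1} \<subseteq> trinomial_quasitorus l1 l2"
    using sum0[OF assms(1)] sum0[OF assms(2)]
    by (auto simp: g_def trinomial_quasitorus_def monomial1_eq monomial2_eq monom_fun_exp)
  have "continuous_on {0..1} g"
    unfolding g_def by (intro continuous_intros)
  then have "connected (g ` {0..1})"
    by (intro connected_continuous_image) auto
  from connectedin_zariski[OF this sub]
  have "g ` {0..1} \<subseteq> connected_component_of_set (subtopology zariski (trinomial_quasitorus l1 l2)) (g 0)"
    by (intro connected_component_of_maximal) auto
  moreover have "g 0 = 1" by (simp add: g_def vec_eq_iff)
  moreover have "g 1 = (\<chi> k. exp (a k))" by (simp add: g_def)
  moreover have "g 1 \<in> g ` {0..1}" by simp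
  ultimately show ?thesis unfolding trinomial_torus_def by (metis subsetD)
qed

lemma monomials_invariant_quasitorus:
  assumes "w \<in> trinomial_quasitorus l1 l2"
  shows "monomial1 l1 (w * x) = monomial1 l1 x" "monomial2 l2 (w * x) = monomial2 l2 x"
  using assms by (auto simp: trinomial_quasitorus_def monomial1_eq monomial2_eq monom_fun_mult)

subsection \<open>Existence of a horizontal curve\<close>

lemma ex_nonzero_exp_family:
  fixes u :: "'a \<Rightarrow> complex"
  assumes "\<And>j. u j \<noteq> 0"
  obtains a where "u = (\<lambda>j. exp (a j))"
  using assms exp_Ln by (metis ext)

text \<open>The diagonal matrix with these logarithms moves the point \<open>exp (a j)\<close> to
  the point with entry \<open>exp s\<close> at \<open>k\<close> and \<open>1\<close> elsewhere. The
  sum must vanish for \<open>exp_in_trinomial_torus\<close>, which is one linear equation for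
  \<open>s\<close>.\<close>

lemma sum_shift_one:
  fixes a :: "'a::finite \<Rightarrow> complex"
  shows "(\<Sum>j\<in>UNIV. of_nat (l j) * ((if j = k then s else 0) - a j))
    = of_nat (l k) * s - (\<Sum>j\<in>UNIV. of_nat (l j) * a j)"
proof -
  have "of_nat (l j) * ((if j = k then s else 0) - a j)
    = (if j = k then of_nat (l k) * s else 0) - of_nat (l j) * a j" for j
    by (simp add: algebra_simps)
  then show ?thesis by (simp add: sum_subtractf)
qed

text \<open>The branches of the logarithm of \<open>u\<close> and \<open>v\<close> are fixed first and the parameter \<open>t\<close> is chosen
  accordingly, so that the resulting torus element lies in the identity component whatever the
  greatest common divisor of the exponents \<open>m\<close> is.\<close>

lemma curve_meets_orbit:
  fixes l :: "'a::finite \<Rightarrow> nat" and m :: "'b::finite \<Rightarrow> nat"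
  assumes "l j0 = 1" "m k0 > 0" "\<And>j. u j \<noteq> 0" "\<And>k. v k \<noteq> 0"
    and eq: "monom_fun l u + monom_fun m v + 1 = 0"
  obtains t a b where "(\<Sum>j\<in>UNIV. of_nat (l j) * a j) = (0::complex)"
    "(\<Sum>k\<in>UNIV. of_nat (m k) * b k) = (0::complex)"
    "\<And>j. (if j = j0 then - 1 - t ^ m k0 else 1) = exp (a j) * u j"
    "\<And>k. (if k = k0 then t else 1) = exp (b k) * v k"
proof -
  obtain c where c: "u = (\<lambda>j. exp (c j))" using ex_nonzero_exp_family assms(3) by metis
  obtain d where d: "v = (\<lambda>j. exp (d j))" using ex_nonzero_exp_family assms(4) by metis
  \<comment> \<open>The solution of that equation for the second block; \<open>t = exp s\<close> is
    the \<open>m k0\<close>-th root of the second monomial singled out by the logarithms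
    \<open>d\<close>.\<close>
  define s where "s = (\<Sum>k\<in>UNIV. of_nat (m k) * d k) / of_nat (m k0)"
  \<comment> \<open>As \<open>l j0 = 1\<close>, the first block is solved without division, and the
    trinomial equation turns \<open>exp r\<close> into \<open>- 1 - t ^ m k0\<close>.\<close>
  define r where "r = (\<Sum>j\<in>UNIV. of_nat (l j) * c j)"
  have s: "of_nat (m k0) * s = (\<Sum>k\<in>UNIV. of_nat (m k) * d k)"
    using assms(2) by (simp add: s_def)
  have "exp s ^ m k0 = monom_fun m v"
    unfolding d monom_fun_exp exp_of_nat_mult[symmetric] s ..
  then have "- 1 - exp s ^ m k0 = exp r"
    using eq by (simp add: c r_def monom_fun_exp algebra_simps add_eq_0_iff)
  then show ?thesis
    by (intro that[of "\<lambda>j. (if j = j0 then r else 0) - c j" "\<lambda>k. (if k = k0 then s else 0) - d k" "exp s"])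
       (auto simp: sum_shift_one assms(1) s, auto simp: r_def c d simp flip: exp_add)
qed

text \<open>The open set is the part of the hypersurface with all coordinates nonzero. Meeting an
  orbit is expressed through logarithms to match \<open>exp_in_trinomial_torus\<close>.\<close>

lemma horizontal_curveI:
  fixes l1 :: "'a::finite \<Rightarrow> nat" and l2 :: "'b::finite \<Rightarrow> nat" and p :: "'a + 'b \<Rightarrow> complex poly"
  assumes X: "\<And>t. (\<chi> k. poly (p k) t) \<in> trinomial_hypersurface l1 l2"
    and deg: "degree (p k1) > 0"
    and ne: "\<And>k. p k \<noteq> 0"
    and orb: "\<And>x. x \<in> trinomial_hypersurface l1 l2 \<Longrightarrow> (\<And>k. x $ k \<noteq> 0) \<Longrightarrow>
      \<exists>t a. (\<Sum>j\<in>UNIV. of_nat (l1 j) * a (Inl j)) = 0 \<and> (\<Sum>j\<in>UNIV. of_nat (l2 j) * a (Inr j)) = 0 \<and>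
        (\<forall>k. poly (p k) t = exp (a k) * x $ k)"
  shows "horizontal_curve (trinomial_torus l1 l2) (trinomial_hypersurface l1 l2) (\<lambda>t. \<chi> k. poly (p k) t)"
proof -
  let ?X = "trinomial_hypersurface l1 l2" and ?T = "trinomial_torus l1 l2"
  let ?\<tau> = "\<lambda>t. \<chi> k. poly (p k) t"
  define W where "W = {x \<in> ?X. \<forall>k. x $ k \<noteq> 0}"
  have nc: "\<not> ?\<tau> constant_on UNIV"
  proof
    assume "?\<tau> constant_on UNIV"
    then obtain c where "\<And>t. ?\<tau> t = c" by (auto simp: constant_on_def)
    then have "\<And>t. poly (p k1) t = c $ k1" by (metis vec_lambda_beta)
    then have "p k1 = [:c $ k1:]" by (intro poly_eqI_degree_lead_coeff poly_ext) auto
    then show False using deg by simp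
  qed
  \<comment> \<open>The coordinate polynomials have finitely many roots in total; any other
    parameter gives a point of \<open>W\<close>.\<close>
  have "finite (\<Union>k. {t. poly (p k) t = 0})"
    by (simp add: ne poly_roots_finite)
  then obtain t where "t \<notin> (\<Union>k. {t. poly (p k) t = 0})"
    using ex_new_if_finite[OF infinite_UNIV_char_0] by blast
  then have "?\<tau> t \<in> W" using X by (auto simp: W_def)
  then have "W \<noteq> {}" by blast
  moreover have "openin (subtopology zariski ?X) W"
    unfolding openin_subtopology using openin_zariski_torus by (auto simp: W_def)
  moreover have "torus_orbit ?T x \<subseteq> W" if "x \<in> W" for x
  proof
    fix y assume "y \<in> torus_orbit ?T x"
    then obtain w where w: "w \<in> trinomial_quasitorus l1 l2" "y = w * x"
      using trinomial_torus_subset[of l1 l2] by (auto simp: torus_orbit_def)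
    have "\<forall>k. w $ k \<noteq> 0" using w(1) by (simp add: trinomial_quasitorus_def)
    then show "y \<in> W"
      using \<open>x \<in> W\<close> monomials_invariant_quasitorus[OF w(1), of x]
      by (simp add: W_def w(2) trinomial_hypersurface_def)
  qed
  moreover have "range ?\<tau> \<inter> torus_orbit ?T x \<noteq> {}" if "x \<in> W" for x
  proof -
    obtain t a where *: "(\<Sum>j\<in>UNIV. of_nat (l1 j) * a (Inl j)) = 0" "(\<Sum>j\<in>UNIV. of_nat (l2 j) * a (Inr j)) = 0"
        "\<And>k. poly (p k) t = exp (a k) * x $ k"
      using orb[of x] \<open>x \<in> W\<close> by (auto simp: W_def)
    have "?\<tau> t = (\<chi> k. exp (a k)) * x" by (simp add: vec_eq_iff *(3))
    then have "?\<tau> t \<in> torus_orbit ?T x"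
      unfolding torus_orbit_def using exp_in_trinomial_torus[OF *(1,2)] by blast
    then show ?thesis by blast
  qed
  ultimately show ?thesis
    unfolding horizontal_curve_def polynomial_curve_def using nc X
    by (intro conjI exI[of _ p] exI[of _ W]) auto
qed

lemma horizontal_curve_exists1:
  fixes l1 :: "'a::finite \<Rightarrow> nat" and l2 :: "'b::finite \<Rightarrow> nat"
  assumes "l1 j0 = 1" "l2 k0 > 0"
  shows "\<exists>\<tau>. horizontal_curve (trinomial_torus l1 l2) (trinomial_hypersurface l1 l2) \<tau>"
proof -
  define p where "p = case_sum (\<lambda>j. if j = j0 then - 1 - [:0, 1:] ^ l2 k0 else 1)
    (\<lambda>k. if k = k0 then [:0, 1::complex:] else 1)"
  have pl: "poly (p (Inl j)) t = (if j = j0 then - 1 - t ^ l2 k0 else 1)" for j t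
    by (simp add: p_def)
  have pr: "poly (p (Inr k)) t = (if k = k0 then t else 1)" for k t
    by (simp add: p_def)
  \<comment> \<open>At parameter 1 every coordinate is 1 or -2.\<close>
  have "poly (p k) 1 \<noteq> 0" for k by (cases k) (auto simp: pl pr)
  then have ne: "p k \<noteq> 0" for k by (metis poly_0)
  have "horizontal_curve (trinomial_torus l1 l2) (trinomial_hypersurface l1 l2) (\<lambda>t. \<chi> k. poly (p k) t)"
  proof (rule horizontal_curveI[OF _ _ ne])
    show "degree (p (Inr k0)) > 0" by (simp add: p_def)
    show "(\<chi> k. poly (p k) t) \<in> trinomial_hypersurface l1 l2" for t
      by (simp add: trinomial_hypersurface_def monomial1_eq monomial2_eq pl pr monom_fun_update_one assms(1))
    show "\<exists>t a. (\<Sum>j\<in>UNIV. of_nat (l1 j) * a (Inl j)) = 0 \<and> (\<Sum>j\<in>UNIV. of_nat (l2 j) * a (Inr j)) = 0 \<and>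
          (\<forall>k. poly (p k) t = exp (a k) * x $ k)"
      if x: "x \<in> trinomial_hypersurface l1 l2" and nz: "\<And>k. x $ k \<noteq> 0" for x
    proof -
      obtain t a b where "(\<Sum>j\<in>UNIV. of_nat (l1 j) * a j) = (0::complex)"
        "(\<Sum>k\<in>UNIV. of_nat (l2 k) * b k) = (0::complex)"
        "\<And>j. (if j = j0 then - 1 - t ^ l2 k0 else 1) = exp (a j) * x $ Inl j"
        "\<And>k. (if k = k0 then t else 1) = exp (b k) * x $ Inr k"
      proof (rule curve_meets_orbit[where l = l1 and m = l2 and u = "\<lambda>j. x $ Inl j" and v = "\<lambda>j. x $ Inr j", OF assms nz nz])
        show "monom_fun l1 (\<lambda>j. x $ Inl j) + monom_fun l2 (\<lambda>j. x $ Inr j) + 1 = 0"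
          using x by (simp add: trinomial_hypersurface_def monomial1_eq monomial2_eq)
      qed (rule that)
      then show ?thesis
        by (intro exI[of _ t] exI[of _ "case_sum a b"]) (simp add: pl pr split_sum_all)
    qed
  qed
  then show ?thesis by blast
qed

text \<open>The mirror image of \<open>horizontal_curve_exists1\<close>:
  \<open>curve_meets_orbit\<close> is applied with the blocks exchanged.\<close>

lemma horizontal_curve_exists2:
  fixes l1 :: "'a::finite \<Rightarrow> nat" and l2 :: "'b::finite \<Rightarrow> nat"
  assumes "l2 k0 = 1" "l1 j0 > 0"
  shows "\<exists>\<tau>. horizontal_curve (trinomial_torus l1 l2) (trinomial_hypersurface l1 l2) \<tau>"
proof -
  define p where "p = case_sum (\<lambda>j. if j = j0 then [:0, 1::complex:] else 1)
    (\<lambda>k. if k = k0 then - 1 - [:0, 1:] ^ l1 j0 else 1)"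
  have pl: "poly (p (Inl j)) t = (if j = j0 then t else 1)" for j t
    by (simp add: p_def)
  have pr: "poly (p (Inr k)) t = (if k = k0 then - 1 - t ^ l1 j0 else 1)" for k t
    by (simp add: p_def)
  have "poly (p k) 1 \<noteq> 0" for k by (cases k) (auto simp: pl pr)
  then have ne: "p k \<noteq> 0" for k by (metis poly_0)
  have "horizontal_curve (trinomial_torus l1 l2) (trinomial_hypersurface l1 l2) (\<lambda>t. \<chi> k. poly (p k) t)"
  proof (rule horizontal_curveI[OF _ _ ne])
    show "degree (p (Inl j0)) > 0" by (simp add: p_def)
    show "(\<chi> k. poly (p k) t) \<in> trinomial_hypersurface l1 l2" for t
      by (simp add: trinomial_hypersurface_def monomial1_eq monomial2_eq pl pr monom_fun_update_one assms(1))
    show "\<exists>t a. (\<Sum>j\<in>UNIV. of_nat (l1 j) * a (Inl j)) = 0 \<and> (\<Sum>j\<in>UNIV. of_nat (l2 j) * a (Inr j)) = 0 \<and>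
          (\<forall>k. poly (p k) t = exp (a k) * x $ k)"
      if x: "x \<in> trinomial_hypersurface l1 l2" and nz: "\<And>k. x $ k \<noteq> 0" for x
    proof -
      obtain t a b where "(\<Sum>k\<in>UNIV. of_nat (l2 k) * b k) = (0::complex)"
        "(\<Sum>j\<in>UNIV. of_nat (l1 j) * a j) = (0::complex)"
        "\<And>k. (if k = k0 then - 1 - t ^ l1 j0 else 1) = exp (b k) * x $ Inr k"
        "\<And>j. (if j = j0 then t else 1) = exp (a j) * x $ Inl j"
      proof (rule curve_meets_orbit[where l = l2 and m = l1 and u = "\<lambda>j. x $ Inr j" and v = "\<lambda>j. x $ Inl j", OF assms nz nz])
        show "monom_fun l2 (\<lambda>j. x $ Inr j) + monom_fun l1 (\<lambda>j. x $ Inl j) + 1 = 0"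
          using x by (simp add: trinomial_hypersurface_def monomial1_eq monomial2_eq add.commute)
      qed (rule that)
      then show ?thesis
        by (intro exI[of _ t] exI[of _ "case_sum a b"]) (simp add: pl pr split_sum_all)
    qed
  qed
  then show ?thesis by blast
qed

subsection \<open>The case of exponents at least two\<close>

text \<open>By the Leibniz rule, differentiation lowers one exponent at a time, and by one only. For
  \<open>l j = 0\<close> truncated subtraction makes the factor 1.\<close>

lemma prod_power_pred_dvd_pderiv:
  fixes p :: "'a \<Rightarrow> 'c::idom poly"
  assumes "finite A"
  shows "(\<Prod>j\<in>A. p j ^ (l j - 1)) dvd pderiv (\<Prod>j\<in>A. p j ^ l j)"
  using assms
proof (induction rule: finite_induct)
  case empty
  then show ?case by simp
next
  case (insert x F)
  have "p x ^ (l x - 1) dvd pderiv (p x ^ l x)"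
    by (cases "l x") (auto simp del: power_Suc simp: pderiv_power_Suc intro: dvd_mult2 dvd_smult)
  moreover have "p x ^ (l x - 1) dvd p x ^ l x" by (intro le_imp_power_dvd) simp
  moreover have "(\<Prod>j\<in>F. p j ^ (l j - 1)) dvd (\<Prod>j\<in>F. p j ^ l j)"
    by (intro prod_dvd_prod le_imp_power_dvd) simp
  ultimately show ?case
    using insert by (auto simp: pderiv_mult mult_ac intro!: dvd_add intro: mult_dvd_mono)
qed

text \<open>From \<open>l j \<ge> 2\<close> follows \<open>l j \<le> 2 * (l j - 1)\<close>: lowering
  every exponent by one keeps at least half of the degree. Here the bound on the exponents enters
  the degree count.\<close>

lemma degree_prod_power_pred:
  fixes p :: "'a::finite \<Rightarrow> 'c::idom poly"
  assumes "\<And>j. l j \<ge> 2" "(\<Prod>j\<in>UNIV. p j ^ l j) \<noteq> 0"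
  shows "degree (\<Prod>j\<in>UNIV. p j ^ l j) \<le> 2 * degree (\<Prod>j\<in>UNIV. p j ^ (l j - 1))"
proof -
  have nz: "p j \<noteq> 0" for j using assms by (auto simp: prod_zero_iff) (metis not_numeral_le_zero)
  have "l j * d \<le> 2 * ((l j - 1) * d)" for j d
  proof -
    have "l j \<le> 2 * (l j - 1)" using assms(1)[of j] by linarith
    then show ?thesis by (metis mult.assoc mult_le_mono1)
  qed
  then show ?thesis
    by (simp add: degree_prod_eq_sum_degree nz degree_power_eq sum_distrib_left sum_mono)
qed

text \<open>A case of the Mason--Stothers theorem: the product of \<open>r\<close> and \<open>s\<close> below, of degree at
  least \<open>degree f\<close>, divides \<open>pderiv f\<close>.\<close>

lemma degree_trinomial_powers:
  fixes p :: "'a::finite \<Rightarrow> complex poly" and q :: "'b::finite \<Rightarrow> complex poly"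
  assumes "\<And>j. l j \<ge> 2" "\<And>k. m k \<ge> 2"
    and eq: "(\<Prod>j\<in>UNIV. p j ^ l j) + (\<Prod>k\<in>UNIV. q k ^ m k) + 1 = 0"
  shows "degree (\<Prod>j\<in>UNIV. p j ^ l j) = 0"
proof (rule ccontr)
  define f g r s where "f = (\<Prod>j\<in>UNIV. p j ^ l j)" and "g = (\<Prod>k\<in>UNIV. q k ^ m k)"
    and "r = (\<Prod>j\<in>UNIV. p j ^ (l j - 1))" and "s = (\<Prod>k\<in>UNIV. q k ^ (m k - 1))"
  assume "degree (\<Prod>j\<in>UNIV. p j ^ l j) \<noteq> 0"
  then have df: "degree f > 0" by (simp add: f_def)
  have g: "g = - (f + 1)" using eq unfolding f_def[symmetric] g_def[symmetric] by algebra
  have dg: "degree g = degree f"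
    using df by (simp only: g degree_minus, intro degree_add_eq_left) simp
  have r: "r dvd f" "r dvd pderiv f" and s: "s dvd g" "s dvd pderiv g"
    unfolding f_def g_def r_def s_def
    by (intro prod_dvd_prod le_imp_power_dvd prod_power_pred_dvd_pderiv; simp)+
  have "pderiv g = - pderiv f" by (simp add: g pderiv_add pderiv_minus pderiv_diff)
  with s have s': "s dvd pderiv f" by simp
  \<comment> \<open>This combination stands in for coprimality of \<open>r\<close> and
    \<open>s\<close>: in the first summand \<open>r\<close> divides \<open>f\<close> and
    \<open>s\<close> divides \<open>pderiv f\<close>, in the second \<open>s\<close> divides
    \<open>g\<close> and \<open>r\<close> divides \<open>pderiv f\<close>.\<close>
  have "r * s dvd f * pderiv f + g * pderiv f"
    using r s(1) s' by (intro dvd_add) (metis mult_dvd_mono mult.commute)+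
  also have "f * pderiv f + g * pderiv f = - pderiv f" by (simp add: g algebra_simps)
  finally have "r * s dvd pderiv f" by simp
  \<comment> \<open>In characteristic zero the derivative of a nonconstant polynomial is nonzero, so
    divisibility bounds the degree.\<close>
  moreover have "pderiv f \<noteq> 0" using df by (simp add: pderiv_eq_0_iff)
  ultimately have "degree (r * s) \<le> degree f - 1"
    using dvd_imp_degree_le[of "r * s" "pderiv f"] by (simp add: degree_pderiv)
  moreover have "r \<noteq> 0" "s \<noteq> 0" using r(1) s(1) df dg by auto
  moreover have "f \<noteq> 0" "g \<noteq> 0" using df dg by auto
  then have "degree f \<le> 2 * degree r" "degree g \<le> 2 * degree s"
    using degree_prod_power_pred[OF assms(1), of p] degree_prod_power_pred[OF assms(2), of q]
    by (simp_all only: f_def g_def r_def s_def)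
  ultimately show False using df dg by (simp add: degree_mult_eq)
qed

subsection \<open>The monomials are nowhere locally constant\<close>

text \<open>Shifting all coordinates by the same \<open>e\<close> gives a polynomial in
  \<open>e\<close> of positive degree, which takes the value \<open>c\<close> only finitely
  often.\<close>

lemma eventually_monom_fun_neq:
  fixes l :: "'a::finite \<Rightarrow> nat"
  assumes "\<And>j. l j > 0"
  shows "\<forall>\<^sub>F e in at 0. monom_fun l (\<lambda>j. u j + e) \<noteq> c"
proof -
  define P where "P = (\<Prod>j\<in>UNIV. [:u j, 1:] ^ l j)"
  have P: "poly P e = monom_fun l (\<lambda>j. u j + e)" for e
    by (simp add: P_def monom_fun_def poly_prod)
  have "degree P = (\<Sum>j\<in>UNIV. l j)"
    unfolding P_def by (subst degree_prod_eq_sum_degree) (auto simp: degree_power_eq)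
  also have "\<dots> > 0" using assms by (simp add: sum_pos)
  finally have "P - [:c:] \<noteq> 0" by auto
  then have "finite {e. poly (P - [:c:]) e = 0}" by (rule poly_roots_finite)
  \<comment> \<open>The root 0 is spared, since the set must be a neighbourhood of 0; the punctured
    filter ignores it anyway.\<close>
  then have "open (- ({e. poly (P - [:c:]) e = 0} - {0}))"
    by (intro open_Compl finite_imp_closed) simp
  then have "\<forall>\<^sub>F e in at 0. e \<in> - ({e. poly (P - [:c:]) e = 0} - {0}) - {0}"
    by (rule eventually_at_in_open) simp
  then show ?thesis by eventually_elim (auto simp: P)
qed

text \<open>The first block is shifted by \<open>e\<close>, and one coordinate of the second is
  rescaled to restore the equation; this requires a nonzero second monomial.\<close>

lemma trinomial_perturb:
  fixes l :: "'a::finite \<Rightarrow> nat" and m :: "'b::finite \<Rightarrow> nat"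
  assumes l: "\<And>j. l j > 0" and m: "\<And>k. m k > 0"
    and eq: "monom_fun l u + monom_fun m v + 1 = 0" and nz: "monom_fun m v \<noteq> 0"
  obtains g :: "complex \<Rightarrow> 'a \<Rightarrow> complex" and h :: "complex \<Rightarrow> 'b \<Rightarrow> complex"
  where "\<And>j. ((\<lambda>e. g e j) \<longlongrightarrow> u j) (at 0)" "\<And>k. ((\<lambda>e. h e k) \<longlongrightarrow> v k) (at 0)"
    "\<forall>\<^sub>F e in at 0. monom_fun l (g e) + monom_fun m (h e) + 1 = 0 \<and> monom_fun l (g e) \<noteq> monom_fun l u"
proof -
  fix k0 :: 'b
  define g where "g = (\<lambda>e j. u j + e)"
  \<comment> \<open>The factor by which the second monomial has to change; its
    \<open>m k0\<close>-th root rescales coordinate \<open>k0\<close>.\<close>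
  define r where "r = (\<lambda>e. (- 1 - monom_fun l (g e)) / monom_fun m v)"
  define h where "h = (\<lambda>e k. (if k = k0 then exp (Ln (r e) / of_nat (m k0)) else 1) * v k)"
  have g: "((\<lambda>e. g e j) \<longlongrightarrow> u j) (at 0)" for j
    unfolding g_def by (auto intro!: tendsto_eq_intros)
  have "((\<lambda>e. monom_fun l (g e)) \<longlongrightarrow> monom_fun l u) (at 0)"
    unfolding monom_fun_def by (intro tendsto_intros g)
  then have "(r \<longlongrightarrow> (- 1 - monom_fun l u) / monom_fun m v) (at 0)"
    unfolding r_def by (intro tendsto_intros nz)
  moreover have "- 1 - monom_fun l u = monom_fun m v" using eq by (simp add: algebra_simps add_eq_0_iff)
  ultimately have r: "(r \<longlongrightarrow> 1) (at 0)" using nz by simp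
  \<comment> \<open>The limit 1 of \<open>r\<close> lies off the branch cut, so the principal
    logarithm is continuous there.\<close>
  then have "((\<lambda>e. exp (Ln (r e) / of_nat (m k0))) \<longlongrightarrow> exp (Ln 1 / of_nat (m k0))) (at 0)"
    using m[of k0] by (intro tendsto_intros) auto
  then have h0: "((\<lambda>e. exp (Ln (r e) / of_nat (m k0))) \<longlongrightarrow> 1) (at 0)" by simp
  have h: "((\<lambda>e. h e k) \<longlongrightarrow> v k) (at 0)" for k
    unfolding h_def using tendsto_mult_right[OF h0, of "v k"] by (cases "k = k0") auto
  have "\<forall>\<^sub>F e in at 0. r e \<noteq> 0" using r by (rule tendsto_imp_eventually_ne) simp
  moreover have "\<forall>\<^sub>F e in at 0. monom_fun l (g e) \<noteq> monom_fun l u"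
    unfolding g_def by (rule eventually_monom_fun_neq[OF l])
  ultimately have "\<forall>\<^sub>F e in at 0. monom_fun l (g e) + monom_fun m (h e) + 1 = 0 \<and> monom_fun l (g e) \<noteq> monom_fun l u"
  proof eventually_elim
    case (elim e)
    have "monom_fun m (h e) = exp (Ln (r e) / of_nat (m k0)) ^ m k0 * monom_fun m v"
      unfolding h_def monom_fun_mult monom_fun_update_one ..
    also have "exp (Ln (r e) / of_nat (m k0)) ^ m k0 = r e"
      using m[of k0] elim(1) by (simp flip: exp_of_nat_mult)
    finally show ?case using nz elim(2) by (simp add: r_def)
  qed
  then show ?thesis using that g h by blast
qed

lemma monomial1_not_constant_on_open:
  fixes l1 :: "'a::finite \<Rightarrow> nat" and l2 :: "'b::finite \<Rightarrow> nat"
  assumes l: "\<And>j. l1 j > 0" "\<And>j. l2 j > 0"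
    and U: "open U" "x \<in> U" "x \<in> trinomial_hypersurface l1 l2"
  obtains y where "y \<in> U" "y \<in> trinomial_hypersurface l1 l2" "monomial1 l1 y \<noteq> monomial1 l1 x"
proof -
  have eq: "monom_fun l1 (\<lambda>j. x $ Inl j) + monom_fun l2 (\<lambda>j. x $ Inr j) + 1 = 0"
    using U(3) by (simp add: trinomial_hypersurface_def monomial1_eq monomial2_eq)
  obtain g :: "complex \<Rightarrow> 'a \<Rightarrow> complex" and h :: "complex \<Rightarrow> 'b \<Rightarrow> complex"
  where g: "\<And>j. ((\<lambda>e. g e j) \<longlongrightarrow> x $ Inl j) (at 0)" and h: "\<And>k. ((\<lambda>e. h e k) \<longlongrightarrow> x $ Inr k) (at 0)"
    and gh: "\<forall>\<^sub>F e in at 0. monom_fun l1 (g e) + monom_fun l2 (h e) + 1 = 0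
      \<and> monom_fun l1 (g e) \<noteq> monom_fun l1 (\<lambda>j. x $ Inl j)"
  \<comment> \<open>The monomials add up to -1, so one of them is nonzero and can take the role of
    the corrected one.\<close>
  proof (cases "monom_fun l2 (\<lambda>j. x $ Inr j) = 0")
    case False
    show ?thesis by (rule trinomial_perturb[OF l eq False]) (rule that)
  next
    case True
    then have nz: "monom_fun l1 (\<lambda>j. x $ Inl j) \<noteq> 0" using eq by auto
    have eq': "monom_fun l2 (\<lambda>j. x $ Inr j) + monom_fun l1 (\<lambda>j. x $ Inl j) + 1 = 0"
      using eq by (simp add: add.commute)
    obtain h :: "complex \<Rightarrow> 'b \<Rightarrow> complex" and g :: "complex \<Rightarrow> 'a \<Rightarrow> complex" where *: "\<And>k. ((\<lambda>e. h e k) \<longlongrightarrow> x $ Inr k) (at 0)" "\<And>j. ((\<lambda>e. g e j) \<longlongrightarrow> x $ Inl j) (at 0)"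
      "\<forall>\<^sub>F e in at 0. monom_fun l2 (h e) + monom_fun l1 (g e) + 1 = 0
      \<and> monom_fun l2 (h e) \<noteq> monom_fun l2 (\<lambda>j. x $ Inr j)"
      using trinomial_perturb[OF l(2,1) eq' nz] by blast
    \<comment> \<open>With the sum of the monomials fixed, a change of the second forces a change of
      the first.\<close>
    from *(3) have "\<forall>\<^sub>F e in at 0. monom_fun l1 (g e) + monom_fun l2 (h e) + 1 = 0
      \<and> monom_fun l1 (g e) \<noteq> monom_fun l1 (\<lambda>j. x $ Inl j)"
      by eventually_elim (metis eq' add.commute add_left_cancel add_right_cancel)
    then show ?thesis using that *(1,2) by blast
  qed
  define y where "y = (\<lambda>e. \<chi> k. case_sum (g e) (h e) k)"
  have "(y \<longlongrightarrow> x) (at 0)"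
  proof (rule vec_tendstoI)
    show "((\<lambda>e. y e $ k) \<longlongrightarrow> x $ k) (at 0)" for k
      by (cases k) (auto simp: y_def g h)
  qed
  then have "\<forall>\<^sub>F e in at 0. y e \<in> U" using U(1,2) by (rule topological_tendstoD)
  with gh have "\<forall>\<^sub>F e in at 0. y e \<in> U \<and> y e \<in> trinomial_hypersurface l1 l2 \<and> monomial1 l1 (y e) \<noteq> monomial1 l1 x"
    by eventually_elim (simp add: y_def trinomial_hypersurface_def monomial1_eq monomial2_eq)
  then show ?thesis using that eventually_happens'[OF at_neq_bot] by blast
qed

text \<open>The first monomial is constant on orbits, so its value on the curve spreads to all of
  \<open>W\<close>; but \<open>W\<close> is Euclidean open in the hypersurface, where this monomial
  varies near every point.\<close>

lemma not_horizontal_if_monomial1_constant: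
  assumes "\<And>j. l1 j > 0" "\<And>j. l2 j > 0"
    and \<tau>: "\<And>t. monomial1 l1 (\<tau> t) = c"
  shows "\<not> horizontal_curve (trinomial_torus l1 l2) (trinomial_hypersurface l1 l2) \<tau>"
proof
  assume "horizontal_curve (trinomial_torus l1 l2) (trinomial_hypersurface l1 l2) \<tau>"
  then obtain W where W: "W \<noteq> {}" "openin (subtopology zariski (trinomial_hypersurface l1 l2)) W"
    "\<And>x. x \<in> W \<Longrightarrow> range \<tau> \<inter> torus_orbit (trinomial_torus l1 l2) x \<noteq> {}"
    unfolding horizontal_curve_def by blast
  have const: "monomial1 l1 x = c" if "x \<in> W" for x
  proof -
    obtain t w where "w \<in> trinomial_torus l1 l2" "\<tau> t = w * x"
      using W(3)[OF \<open>x \<in> W\<close>] by (auto simp: torus_orbit_def)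
    then show ?thesis
      using \<tau>[of t] monomials_invariant_quasitorus(1) trinomial_torus_subset by (metis subsetD)
  qed
  obtain U where U: "openin zariski U" "W = U \<inter> trinomial_hypersurface l1 l2"
    using W(2) by (auto simp: openin_subtopology)
  obtain x where x: "x \<in> W" using W(1) by blast
  obtain y where "y \<in> W" "monomial1 l1 y \<noteq> monomial1 l1 x"
    using monomial1_not_constant_on_open[of l1 l2 U x] assms(1,2) open_if_openin_zariski[OF U(1)] x U(2)
    by blast
  then show False using const x by metis
qed

section \<open>Equivalence of horizontal curves and an exponent equal to one\<close>

theorem theorem4:
  fixes l1 :: "'a::finite \<Rightarrow> nat" and l2 :: "'b::finite \<Rightarrow> nat"
  assumes "\<And>j. l1 j > 0" and "\<And>j. l2 j > 0"
  shows "(\<exists>\<tau>. horizontal_curve (trinomial_torus l1 l2) (trinomial_hypersurface l1 l2) \<tau>)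
    \<longleftrightarrow> (\<exists>j. l1 j = 1) \<or> (\<exists>j. l2 j = 1)"
proof
  assume "(\<exists>j. l1 j = 1) \<or> (\<exists>j. l2 j = 1)"
  then show "\<exists>\<tau>. horizontal_curve (trinomial_torus l1 l2) (trinomial_hypersurface l1 l2) \<tau>" (is ?ex)
  proof (elim disjE exE)
    fix j assume "l1 j = 1"
    then show ?ex by (rule horizontal_curve_exists1) (rule assms(2))
  next
    fix j assume "l2 j = 1"
    then show ?ex by (rule horizontal_curve_exists2) (rule assms(1))
  qed
next
  assume "\<exists>\<tau>. horizontal_curve (trinomial_torus l1 l2) (trinomial_hypersurface l1 l2) \<tau>"
  then obtain \<tau> where hor: "horizontal_curve (trinomial_torus l1 l2) (trinomial_hypersurface l1 l2) \<tau>"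
    by blast
  then obtain p where \<tau>: "\<And>t. \<tau> t = (\<chi> k. poly (p k) t)"
    and X: "\<And>t. \<tau> t \<in> trinomial_hypersurface l1 l2"
    unfolding horizontal_curve_def polynomial_curve_def by blast
  show "(\<exists>j. l1 j = 1) \<or> (\<exists>j. l2 j = 1)"
  proof (rule ccontr)
    assume not1: "\<not> ((\<exists>j. l1 j = 1) \<or> (\<exists>j. l2 j = 1))"
    have ge2: "l1 j \<ge> 2" "l2 k \<ge> 2" for j k
      using not1 assms(1)[of j] assms(2)[of k] by (metis One_nat_def Suc_1 Suc_leI le_neq_implies_less)+
    let ?f = "\<Prod>j\<in>UNIV. p (Inl j) ^ l1 j" and ?g = "\<Prod>j\<in>UNIV. p (Inr j) ^ l2 j"
    have f: "monomial1 l1 (\<tau> t) = poly ?f t" for t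
      by (simp add: monomial1_eq \<tau> poly_monom_fun)
    have g: "monomial2 l2 (\<tau> t) = poly ?g t" for t
      by (simp add: monomial2_eq \<tau> poly_monom_fun)
    have "poly (?f + ?g + 1) t = poly 0 t" for t
      using X[of t] by (simp add: trinomial_hypersurface_def f g)
    \<comment> \<open>Polynomials agreeing at every complex number are equal, which turns the
      equation along the curve into a polynomial identity.\<close>
    then have "?f + ?g + 1 = 0" by (metis poly_ext)
    then have "degree ?f = 0" by (intro degree_trinomial_powers[where m = l2] ge2)
    then obtain c where "?f = [:c:]" by (metis degree_eq_zeroE)
    then have "monomial1 l1 (\<tau> t) = c" for t by (simp add: f)
    then show False using not_horizontal_if_monomial1_constant[of l1 l2 \<tau> c] assms hor by simp
  qed
qed

end
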